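(* Let $F$ be a finite field and let $C,D\subseteq F^n$ be MDS codes with $\dim C,\dim D\ge2$ and $\dim CD\le n-2$. If $$\dim CD=\dim C+\dim D-1,$$ then $C$ and $D$ are Reed-Solomon codes with a common evaluation-point sequence.
   Context: A code is an $F$-linear subspace of $F^n$. For $x,y\in F^n$, $xy$ denotes the coordinatewise product; $CD$ is the $F$-span of all $xy$ with $x\in C$, $y\in D$. A non-zero code $C\subseteq F^n$ is MDS if $\dim C+d_{\min}(C)=n+1$, where $d_{\min}(C)$ is the minimum Hamming weight of a non-zero vector of $C$. A Reed-Solomon code of length $n$ and dimension $k$ is a code of the form $\{(g_1f(\alpha_1),\dots,g_nf(\alpha_n)): f\in F[X],\ \deg f<k\}$, where $g_1,\dots,g_n\in F$ are non-zero and $\alpha_1,\dots,\alpha_n\in F\cup\{\infty\}$ are pairwise distinct (with $1\le k\le n$), with the convention that $f(\infty)$ is the coefficient of $X^{k-1}$ in $f$; $(\alpha_1,\dots,\alpha_n)$ is called an evaluation-point sequence for the code. *)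

theory Defs
  imports "HOL-Analysis.Cartesian_Space" "HOL-Computational_Algebra.Polynomial"
begin

text \<open>
  \<open>F\<^sup>n\<close> is \<^typ>\<open>'a ^ 'n\<close> with \<open>n = CARD('n)\<close>; linear notions are those of the library's
  vector space locale interpretation \<open>vec\<close> (scalar multiplication \<open>*s\<close>), and \<open>*\<close> on vectors is
  the library's coordinatewise product.
\<close>

type_synonym ('a, 'n) code = "('a ^ 'n) set"

abbreviation is_code :: "('a::field, 'n::finite) code \<Rightarrow> bool"
  where "is_code \<equiv> vec.subspace"

definition code_prod :: "('a::field, 'n::finite) code \<Rightarrow> ('a, 'n) code \<Rightarrow> ('a, 'n) code"
  where "code_prod C D = vec.span {x * y | x y. x \<in> C \<and> y \<in> D}"

definition hamming_weight :: "'a::field ^ 'n::finite \<Rightarrow> nat"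
  where "hamming_weight x = card {i. x $ i \<noteq> 0}"

text \<open>Only meaningful for codes containing a non-zero vector.\<close>

definition min_distance :: "('a::field, 'n::finite) code \<Rightarrow> nat"
  where "min_distance C = Min (hamming_weight ` (C - {0}))"

definition is_MDS :: "('a::field, 'n::finite) code \<Rightarrow> bool"
  where "is_MDS C \<longleftrightarrow>
    is_code C \<and> C \<noteq> {0} \<and> vec.dim C + min_distance C = CARD('n) + 1"

text \<open>
  Points of \<open>F \<union> {\<infinity>}\<close> are elements of \<^typ>\<open>'a option\<close>, with \<^term>\<open>None\<close> for \<open>\<infinity>\<close>.
  The value of a polynomial at \<open>\<infinity>\<close> depends on the dimension \<open>k\<close> of the code.
\<close>

fun eval_point :: "nat \<Rightarrow> 'a::field poly \<Rightarrow> 'a option \<Rightarrow> 'a"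
  where
    "eval_point k f (Some a) = poly f a"
  | "eval_point k f None = coeff f (k - 1)"

text \<open>For \<open>k \<ge> 1\<close>, \<open>degree f < k\<close> includes the zero polynomial, as \<open>degree 0 = 0\<close>.\<close>

definition RS_code :: "nat \<Rightarrow> ('n::finite \<Rightarrow> 'a::field) \<Rightarrow> ('n \<Rightarrow> 'a option) \<Rightarrow> ('a, 'n) code"
  where "RS_code k g \<alpha> = {(\<chi> i. g i * eval_point k f (\<alpha> i)) | f. degree f < k}"

definition RS_evaluation_points :: "('n::finite \<Rightarrow> 'a::field option) \<Rightarrow> ('a, 'n) code \<Rightarrow> bool"
  where "RS_evaluation_points \<alpha> C \<longleftrightarrow>
    inj \<alpha> \<and> (\<exists>k g. 1 \<le> k \<and> k \<le> CARD('n) \<and> (\<forall>i. g i \<noteq> 0) \<and> C = RS_code k g \<alpha>)"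

end

theory Submission imports Defs begin

text \<open>
  Let \<open>k\<close>, \<open>l\<close> be the dimensions of \<open>C\<close>, \<open>D\<close>. Products of words of \<open>C\<close> and \<open>D\<close> with
  prescribed zeros show that a word of \<open>CD\<close> with \<open>k + l - 1\<close> zeros vanishes. Hence, on a set \<open>S\<close> of
  \<open>k + l + 1\<close> coordinates, \<open>CD\<close> has two independent parity checks \<open>u\<close>, \<open>v\<close>, and the points
  \<open>(u\<^sub>i : v\<^sub>i)\<close> of the projective line are distinct. Both \<open>uC\<close> and \<open>vC\<close> are orthogonal to \<open>D\<close>, so
  that \<open>\<langle>u, v\<rangle>C\<close> has dimension at most \<open>k + 1\<close> on \<open>S\<close>; repeated division of \<open>C\<close> by
  \<open>\<langle>u, v\<rangle>\<close> then shows that \<open>C\<close> is spanned by words \<open>c\<^sub>a\<close> agreeing on \<open>S\<close> with \<open>g u\<^sup>a v\<^bsup>k-1-a\<^esup>\<close>, and likewise \<open>D\<close> by words \<open>d\<^sub>b\<close>.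
  The word \<open>c\<^sub>a d\<^bsub>b+1\<^esub> - c\<^bsub>a+1\<^esub> d\<^sub>b\<close> of \<open>CD\<close> vanishes on \<open>S\<close>, hence everywhere. So at
  every coordinate the values of the \<open>c\<^sub>a\<close> and of the \<open>d\<^sub>b\<close> form geometric sequences with the same ratio
  in \<open>F \<union> {\<infinity>}\<close>, which is the evaluation point.
\<close>

subsection \<open>Division by a two-dimensional code\<close>

text \<open>A distance bound for the code punctured to \<open>S\<close>: a word not vanishing on
  \<open>S\<close> has weight at least \<open>card S - m + 1\<close> there. It is separate from
  \<open>mds_on\<close> because the ambient code \<open>E\<close> enters only through this
  bound.\<close>

definition few_zeros :: "'n set \<Rightarrow> nat \<Rightarrow> ('a::field, 'n::finite) code \<Rightarrow> bool"
  where "few_zeros S m V \<longleftrightarrow>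
    (\<forall>x\<in>V. \<forall>Z\<subseteq>S. m \<le> card Z \<longrightarrow> (\<forall>i\<in>Z. x $ i = 0) \<longrightarrow> (\<forall>i\<in>S. x $ i = 0))"

text \<open>
  A code on the coordinates in \<open>S\<close> is represented by its full preimage, with arbitrary entries
  outside \<open>S\<close>.
\<close>

definition mds_on :: "'n set \<Rightarrow> nat \<Rightarrow> ('a::field, 'n::finite) code \<Rightarrow> bool"
  where "mds_on S k V \<longleftrightarrow>
    vec.subspace V \<and>
    (\<forall>x\<in>V. \<forall>y. (\<forall>i\<in>S. y $ i = x $ i) \<longrightarrow> y \<in> V) \<and>
    few_zeros S k V \<and>
    (\<forall>Z\<subseteq>S. card Z < k \<longrightarrow> (\<exists>x\<in>V. (\<forall>i\<in>Z. x $ i = 0) \<and> (\<exists>i\<in>S. x $ i \<noteq> 0)))"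

text \<open>Distinctness of the projective points (\<open>u_i\<close> : \<open>v_i\<close>),
  cross-multiplied so that \<open>v_i = 0\<close> may stand for infinity. If \<open>S\<close> has
  two elements, (0 : 0) is excluded as well.\<close>

definition pairwise_independent_on :: "'n set \<Rightarrow> 'a::field ^ 'n::finite \<Rightarrow> 'a ^ 'n \<Rightarrow> bool"
  where "pairwise_independent_on S u v \<longleftrightarrow>
    (\<forall>i\<in>S. \<forall>j\<in>S. i \<noteq> j \<longrightarrow> u $ i * v $ j \<noteq> u $ j * v $ i)"

lemma few_zerosD:
  assumes "few_zeros S m V" "x \<in> V" "Z \<subseteq> S" "m \<le> card Z" "\<And>i. i \<in> Z \<Longrightarrow> x $ i = 0" "i \<in> S"
  shows "x $ i = 0"
  using assms unfolding few_zeros_def by blast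

lemma mds_on_cong:
  assumes "mds_on S k V" "x \<in> V" "\<And>i. i \<in> S \<Longrightarrow> y $ i = x $ i"
  shows "y \<in> V"
  using assms unfolding mds_on_def by blast

lemma mds_on_lincomb:
  assumes "mds_on S k V" "x \<in> V" "y \<in> V"
  shows "a *s x + b *s y \<in> V"
  using assms unfolding mds_on_def by (auto intro: vec.subspace_add vec.subspace_scale)

text \<open>The last clause of \<open>mds_on\<close> supplies a word with these \<open>k\<close>
  zeros; a further zero in \<open>S\<close> would be one too many.\<close>

lemma mds_on_nonvanishing:
  assumes "mds_on S (Suc k) V" "Z \<subseteq> S" "card Z = k"
  obtains x where "x \<in> V" "\<And>i. i \<in> Z \<Longrightarrow> x $ i = 0" "\<And>i. i \<in> S - Z \<Longrightarrow> x $ i \<noteq> 0"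
proof -
  from assms obtain x i where x: "x \<in> V" "\<forall>i\<in>Z. x $ i = 0" and i: "i \<in> S" "x $ i \<noteq> 0"
    unfolding mds_on_def by (metis lessI)
  have "x $ j \<noteq> 0" if j: "j \<in> S - Z" for j
  proof
    assume "x $ j = 0"
    then have "x $ i = 0"
      using assms x j i(1) unfolding mds_on_def
      by (intro few_zerosD[of S "Suc k" V x "insert j Z" i]) auto
    with i(2) show False by simp
  qed
  with x that show ?thesis by blast
qed

text \<open>
  Dividing two words of \<open>V\<close> with the zero sets \<open>Z \<union> {p}\<close> and \<open>Z \<union> {q}\<close> by the
  elements of \<open>\<langle>u, v\<rangle>\<close> vanishing at \<open>p\<close> and \<open>q\<close> gives the same word up to a scalar, since the
  cross products lie in \<open>E\<close> and share as many zeros as \<open>E\<close> allows.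
\<close>

lemma mds_on_divide:
  fixes u v :: "'a::field ^ 'n::finite"
  assumes uv: "pairwise_independent_on S u v"
    and V: "mds_on S (Suc k) V" and "k \<ge> 1" and S: "card S \<ge> k + 2"
    and E: "few_zeros S (k + 2) E" "vec.subspace E"
    and VE: "\<And>x. x \<in> V \<Longrightarrow> u * x \<in> E" "\<And>x. x \<in> V \<Longrightarrow> v * x \<in> E"
  shows "mds_on S k {w. u * w \<in> V \<and> v * w \<in> V}" (is "mds_on S k ?W")
proof -
  have V0: "vec.subspace V" and Vf: "few_zeros S (Suc k) V"
    using V by (auto simp: mds_on_def)
  \<comment> \<open>For \<open>p\<close> in \<open>S\<close> this is, up to scaling, the combination
    of \<open>u\<close> and \<open>v\<close> vanishing at \<open>p\<close>; pairwise independence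
    keeps it nonzero on the rest of \<open>S\<close>.\<close>
  define X where "X p = v $ p *s u - u $ p *s v" for p
  have X_eq: "X p $ i = v $ p * u $ i - u $ p * v $ i" for p i
    by (simp add: X_def)
  have Xpp: "X p $ p = 0" for p by (simp add: X_eq)
  have Xnz: "X p $ i \<noteq> 0" if "p \<in> S" "i \<in> S" "p \<noteq> i" for p i
    using uv that unfolding pairwise_independent_on_def X_eq by (auto simp: mult.commute)
  have XV: "X p * w \<in> V" if "w \<in> ?W" for p w
  proof -
    have "v $ p *s (u * w) + (- u $ p) *s (v * w) \<in> V"
      using that by (intro mds_on_lincomb[OF V]) auto
    also have "v $ p *s (u * w) + (- u $ p) *s (v * w) = X p * w"
      by (simp add: vec_eq_iff X_eq algebra_simps)
    finally show ?thesis .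
  qed
  have XE: "X p * x \<in> E" if "x \<in> V" for p x
  proof -
    have "v $ p *s (u * x) - u $ p *s (v * x) \<in> E"
      using that VE E(2) by (intro vec.subspace_diff vec.subspace_scale) auto
    also have "v $ p *s (u * x) - u $ p *s (v * x) = X p * x"
      by (simp add: vec_eq_iff X_eq algebra_simps)
    finally show ?thesis .
  qed
  show ?thesis
    unfolding mds_on_def
  proof (intro conjI ballI allI impI)
    show "vec.subspace ?W"
      unfolding vec.subspace_def
    proof (intro conjI ballI allI)
      show "0 \<in> ?W" using vec.subspace_0[OF V0] by simp
    next
      fix x y assume "x \<in> ?W" "y \<in> ?W"
      then show "x + y \<in> ?W" using vec.subspace_add[OF V0] by (simp add: distrib_left)
    next
      fix c x assume x: "x \<in> ?W"
      have "u * (c *s x) = c *s (u * x)" "v * (c *s x) = c *s (v * x)"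
        by (simp_all add: vec_eq_iff algebra_simps)
      then show "c *s x \<in> ?W" using x vec.subspace_scale[OF V0] by simp
    qed
  next
    fix x y assume "x \<in> ?W" "\<forall>i\<in>S. y $ i = x $ i"
    then show "y \<in> ?W"
      by (auto intro: mds_on_cong[OF V])
  next
    show "few_zeros S k ?W"
      unfolding few_zeros_def
    proof (intro ballI allI impI)
      fix w Z' i assume w: "w \<in> ?W" and Z': "Z' \<subseteq> S" "k \<le> card Z'" "\<forall>i\<in>Z'. w $ i = 0" and i: "i \<in> S"
      obtain Z where Z: "Z \<subseteq> Z'" "card Z = k" using Z'(2) by (meson obtain_subset_with_card_n)
      show "w $ i = 0"
      proof (cases "i \<in> Z")
        case True
        then show ?thesis using Z Z' by blast
      next
        case False
        \<comment> \<open>With \<open>j\<close> outside \<open>Z\<close> and different from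
          \<open>i\<close>, the word \<open>X j * w\<close> of \<open>V\<close> has the
          \<open>k + 1\<close> zeros \<open>insert j Z\<close>, while \<open>X j\<close> can be
          cancelled at \<open>i\<close>.\<close>
        have "card (insert i Z) < card S" using False Z S by simp
        then obtain j where j: "j \<in> S" "j \<notin> insert i Z"
          by (meson card_mono finite linorder_not_less subsetI)
        have "(X j * w) $ i = 0"
          by (rule few_zerosD[OF Vf XV[OF w, of j], of "insert j Z"])
            (use j Z Z' i in \<open>auto simp: Xpp\<close>)
        with Xnz[of j i] i j show ?thesis by auto
      qed
    qed
  next
    fix Z0 assume Z0: "Z0 \<subseteq> S" "card Z0 < k"
    \<comment> \<open>Three points beyond \<open>k - 1\<close> zeros are needed: \<open>p\<close>
      and \<open>q\<close> are the extra zeros of the two words to be divided, and \<open>m\<close>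
      fixes their ratio and witnesses that the quotient is nonzero.\<close>
    have "card Z0 \<le> k - 1" "k - 1 \<le> card S" using Z0 S by auto
    then obtain Z where Z: "Z0 \<subseteq> Z" "Z \<subseteq> S" "card Z = k - 1"
      using exists_subset_between[of Z0 "k - 1" S] Z0 by auto
    have cSZ: "card (S - Z) = card S - (k - 1)" using Z by (simp add: card_Diff_subset)
    have "3 \<le> card (S - Z)" using cSZ S \<open>k \<ge> 1\<close> by linarith
    then obtain R where R: "R \<subseteq> S - Z" "card R = 3" by (meson obtain_subset_with_card_n)
    then obtain p q m where "R = {p, q, m}" "p \<noteq> q" "q \<noteq> m" "p \<noteq> m"
      by (auto simp: card_3_iff)
    with R have pq: "p \<in> S" "q \<in> S" "m \<in> S" "p \<notin> Z" "q \<notin> Z" "m \<notin> Z" "p \<noteq> q" "m \<noteq> p" "m \<noteq> q"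
      by auto
    obtain c where c: "c \<in> V" "\<And>i. i \<in> insert p Z \<Longrightarrow> c $ i = 0" "\<And>i. i \<in> S - insert p Z \<Longrightarrow> c $ i \<noteq> 0"
      by (rule mds_on_nonvanishing[OF V, of "insert p Z"]) (use pq Z \<open>k \<ge> 1\<close> in auto)
    obtain d where d: "d \<in> V" "\<And>i. i \<in> insert q Z \<Longrightarrow> d $ i = 0" "\<And>i. i \<in> S - insert q Z \<Longrightarrow> d $ i \<noteq> 0"
      by (rule mds_on_nonvanishing[OF V, of "insert q Z"]) (use pq Z \<open>k \<ge> 1\<close> in auto)
    \<comment> \<open>Chosen so that \<open>X q * c - r *s (X p * d)\<close> vanishes at
      \<open>m\<close> too; together with \<open>Z\<close>, \<open>p\<close> and \<open>q\<close>
      this makes \<open>k + 2\<close> zeros.\<close>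
    define r where "r = X q $ m * c $ m / (X p $ m * d $ m)"
    have nz: "X p $ m \<noteq> 0" "X q $ m \<noteq> 0" "d $ m \<noteq> 0" "X p $ q \<noteq> 0" "X q $ p \<noteq> 0"
      using Xnz pq d(3)[of m] by auto
    have cross: "X q $ i * c $ i = r * X p $ i * d $ i" if "i \<in> S" for i
    proof -
      have "X q * c - r *s (X p * d) \<in> E"
        using XE c(1) d(1) E(2) by (intro vec.subspace_diff vec.subspace_scale) auto
      then have "(X q * c - r *s (X p * d)) $ i = 0"
      proof (rule few_zerosD[OF E(1), of _ "insert m (insert p (insert q Z))"])
        show "k + 2 \<le> card (insert m (insert p (insert q Z)))" using pq Z \<open>k \<ge> 1\<close> by simp
        show "(X q * c - r *s (X p * d)) $ j = 0" if "j \<in> insert m (insert p (insert q Z))" for j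
          using that c(2)[of j] d(2)[of j] nz by (auto simp: Xpp r_def)
      qed (use pq Z that in auto)
      then show ?thesis by (simp add: algebra_simps)
    qed
    \<comment> \<open>The quotient of \<open>c\<close> by \<open>X p\<close>. At \<open>p\<close>
      this reads 0/0, so the value is taken from the quotient of \<open>r *s d\<close> by
      \<open>X q\<close>; entries outside \<open>S\<close> are immaterial.\<close>
    define w where "w = (\<chi> i. if i = p then r * d $ p / X q $ p else c $ i / X p $ i)"
    have Xpw: "(X p * w) $ i = c $ i" if "i \<in> S" for i
      using that Xnz[of p i] pq c(2)[of p] by (auto simp: w_def Xpp)
    have Xqw: "(X q * w) $ i = (r *s d) $ i" if "i \<in> S" for i
      using that Xnz[of p i] pq nz cross[OF that] by (auto simp: w_def Xpp field_simps)
    have XpV: "X p * w \<in> V"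
      by (rule mds_on_cong[OF V c(1)]) (use Xpw in auto)
    have XqV: "X q * w \<in> V"
      by (rule mds_on_cong[OF V vec.subspace_scale[OF V0 d(1), of r]]) (use Xqw in auto)
    \<comment> \<open>\<open>X p\<close> and \<open>X q\<close> span the same space as
      \<open>u\<close> and \<open>v\<close>; the coefficients come from Cramer's rule.\<close>
    have "u * w = (u $ q / X p $ q) *s (X p * w) + (- u $ p / X p $ q) *s (X q * w)"
      using nz by (simp add: vec_eq_iff field_simps) (simp add: X_eq algebra_simps)
    then have uw: "u * w \<in> V" by (simp only: mds_on_lincomb[OF V XpV XqV])
    have "v * w = (v $ q / X p $ q) *s (X p * w) + (- v $ p / X p $ q) *s (X q * w)"
      using nz by (simp add: vec_eq_iff field_simps) (simp add: X_eq algebra_simps)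
    then have vw: "v * w \<in> V" by (simp only: mds_on_lincomb[OF V XpV XqV])
    show "\<exists>x\<in>?W. (\<forall>i\<in>Z0. x $ i = 0) \<and> (\<exists>i\<in>S. x $ i \<noteq> 0)"
    proof (intro bexI conjI ballI)
      show "w \<in> ?W" using uw vw by simp
      show "w $ i = 0" if "i \<in> Z0" for i using that Z pq c(2)[of i] by (auto simp: w_def)
      show "w $ m \<noteq> 0" using pq c(3)[of m] nz by (auto simp: w_def)
    qed (use pq in auto)
  qed
qed

text \<open>Induction on \<open>k\<close> by division: \<open>V\<close> itself serves as the ambient
  code \<open>E\<close> of its quotient. At the bottom, a word without zeros on \<open>S\<close> is
  the required \<open>g\<close>; multiplying back by \<open>v\<close> (for \<open>a = 0\<close>) or
  by \<open>u\<close> (for \<open>a > 0\<close>) yields the words of \<open>V\<close>.\<close>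

lemma mds_on_geometric:
  fixes u v :: "'a::field ^ 'n::finite"
  assumes uv: "pairwise_independent_on S u v"
    and "mds_on S (Suc k) V" and "card S \<ge> k + 2"
    and "few_zeros S (k + 2) E" "vec.subspace E"
    and "\<And>x. x \<in> V \<Longrightarrow> u * x \<in> E" "\<And>x. x \<in> V \<Longrightarrow> v * x \<in> E"
  shows "\<exists>g. (\<forall>i\<in>S. g $ i \<noteq> 0) \<and> (\<forall>a\<le>k. (\<chi> i. g $ i * u $ i ^ a * v $ i ^ (k - a)) \<in> V)"
  using assms(2-)
proof (induction k arbitrary: V E)
  case 0
  obtain x where "x \<in> V" "\<And>i. i \<in> S \<Longrightarrow> x $ i \<noteq> 0"
    using mds_on_nonvanishing[OF 0(1), of "{}"] by auto
  then show ?case by (intro exI[of _ x]) simp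
next
  case (Suc k)
  let ?W = "{w. u * w \<in> V \<and> v * w \<in> V}"
  have "mds_on S (Suc k) ?W"
    by (rule mds_on_divide[OF uv Suc.prems(1), of E]) (use Suc.prems in auto)
  moreover have "few_zeros S (k + 2) V" "vec.subspace V"
    using Suc.prems(1) by (auto simp: mds_on_def)
  ultimately have "\<exists>g. (\<forall>i\<in>S. g $ i \<noteq> 0) \<and> (\<forall>a\<le>k. (\<chi> i. g $ i * u $ i ^ a * v $ i ^ (k - a)) \<in> ?W)"
    using Suc.prems(2) by (intro Suc.IH[of ?W V]) simp_all
  then obtain g where g: "\<forall>i\<in>S. g $ i \<noteq> 0"
    "\<And>a. a \<le> k \<Longrightarrow> (\<chi> i. g $ i * u $ i ^ a * v $ i ^ (k - a)) \<in> ?W"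
    by blast
  have "(\<chi> i. g $ i * u $ i ^ a * v $ i ^ (Suc k - a)) \<in> V" if "a \<le> Suc k" for a
  proof (cases a)
    case 0
    have "v * (\<chi> i. g $ i * u $ i ^ 0 * v $ i ^ (k - 0)) \<in> V" using g(2)[of 0] by blast
    also have "v * (\<chi> i. g $ i * u $ i ^ 0 * v $ i ^ (k - 0)) = (\<chi> i. g $ i * u $ i ^ a * v $ i ^ (Suc k - a))"
      by (simp add: vec_eq_iff 0)
    finally show ?thesis .
  next
    case (Suc b)
    have "u * (\<chi> i. g $ i * u $ i ^ b * v $ i ^ (k - b)) \<in> V" using g(2)[of b] Suc that by auto
    also have "u * (\<chi> i. g $ i * u $ i ^ b * v $ i ^ (k - b)) = (\<chi> i. g $ i * u $ i ^ a * v $ i ^ (Suc k - a))"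
      by (simp add: vec_eq_iff Suc)
    finally show ?thesis .
  qed
  with g(1) show ?case by blast
qed

subsection \<open>Words of MDS codes with prescribed zeros\<close>

text \<open>A version for indexed families: injectivity follows from \<open>indep\<close>, since a
  repeated member would give a relation with coefficients 1 and -1.\<close>

lemma in_lincombs_if_card_eq_dim:
  fixes b :: "'i \<Rightarrow> 'a::field ^ 'n::finite"
  assumes "finite I" and bV: "\<And>i. i \<in> I \<Longrightarrow> b i \<in> V" and card: "card I = vec.dim V"
    and indep: "\<And>r i. (\<Sum>i\<in>I. r i *s b i) = 0 \<Longrightarrow> i \<in> I \<Longrightarrow> r i = 0"
    and "x \<in> V"
  shows "\<exists>r. x = (\<Sum>i\<in>I. r i *s b i)"
proof -
  have inj: "inj_on b I"
  proof (rule inj_onI, rule ccontr)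
    fix i j assume ij: "i \<in> I" "j \<in> I" "b i = b j" "i \<noteq> j"
    define r :: "'i \<Rightarrow> 'a" where "r l = (if l = i then 1 else if l = j then -1 else 0)" for l
    have "(\<Sum>l\<in>I. r l *s b l) = (\<Sum>l\<in>{i, j}. r l *s b l)"
      using ij \<open>finite I\<close> by (intro sum.mono_neutral_right) (auto simp: r_def)
    also have "\<dots> = 0" using ij by (simp add: r_def)
    finally have "r i = 0" using indep ij by blast
    then show False by (simp add: r_def)
  qed
  have "vec.independent (b ` I)"
  proof
    assume "vec.dependent (b ` I)"
    then obtain r y where y: "y \<in> b ` I" "r y \<noteq> 0" and "(\<Sum>y\<in>b ` I. r y *s y) = 0"
      using vec.dependent_finite[of "b ` I"] \<open>finite I\<close> by auto
    then have "(\<Sum>i\<in>I. r (b i) *s b i) = 0"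
      by (simp add: sum.reindex[OF inj])
    from indep[OF this] y show False by auto
  qed
  moreover have "b ` I \<subseteq> V" using bV by auto
  ultimately have "V \<subseteq> vec.span (b ` I)"
    using card by (intro vec.card_ge_dim_independent) (simp_all add: card_image[OF inj])
  with \<open>x \<in> V\<close> obtain r where "x = (\<Sum>y\<in>b ` I. r y *s y)"
    using vec.span_finite[of "b ` I"] \<open>finite I\<close> by auto
  then have "x = (\<Sum>i\<in>I. r (b i) *s b i)" by (simp add: sum.reindex[OF inj])
  then show ?thesis by (intro exI[of _ "\<lambda>i. r (b i)"])
qed

text \<open>Otherwise the projection to the coordinates in \<open>Z\<close> would be injective on
  \<open>V\<close>, forcing the dimension down to \<open>card Z\<close>.\<close>

lemma exists_nonzero_vanishing:
  fixes V :: "('a::field, 'n::finite) code"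
  assumes V: "vec.subspace V" and "card Z < vec.dim V"
  shows "\<exists>x\<in>V. x \<noteq> 0 \<and> (\<forall>i\<in>Z. x $ i = 0)"
proof (rule ccontr)
  assume contra: "\<not> ?thesis"
  define h :: "'a ^ 'n \<Rightarrow> 'a ^ 'n" where "h x = (\<chi> i. if i \<in> Z then x $ i else 0)" for x
  have lin: "Vector_Spaces.linear (*s) (*s) h"
    unfolding Vector_Spaces.linear_iff by (auto simp: h_def vec_eq_iff vec.vector_space_axioms)
  have "inj_on h (vec.span V)"
  proof (rule inj_onI)
    fix x y assume xy: "x \<in> vec.span V" "y \<in> vec.span V" "h x = h y"
    then have "x - y \<in> V" using V by (metis vec.span_eq_iff vec.subspace_diff)
    moreover have "\<forall>i\<in>Z. (x - y) $ i = 0"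
      using xy(3) by (auto simp: h_def vec_eq_iff split: if_splits)
    ultimately show "x = y" using contra by auto
  qed
  then have "vec.dim (h ` V) = vec.dim V" by (rule vec.dim_image_eq[OF lin])
  moreover have "h ` V \<subseteq> vec.span ((\<lambda>i. axis i 1) ` Z)"
  proof
    fix y assume "y \<in> h ` V"
    then obtain x where x: "y = h x" by auto
    have "y = (\<Sum>i\<in>Z. x $ i *s axis i 1)"
      by (simp add: vec_eq_iff x h_def axis_def if_distrib[of "\<lambda>z. _ * z"] sum.delta cong: if_cong)
    also have "\<dots> \<in> vec.span ((\<lambda>i. axis i 1) ` Z)"
      by (intro vec.span_sum vec.span_scale vec.span_base) auto
    finally show "y \<in> vec.span ((\<lambda>i. axis i 1) ` Z)" .
  qed
  then have "vec.dim (h ` V) \<le> card ((\<lambda>i. axis i 1 :: 'a ^ 'n) ` Z)"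
    by (rule vec.dim_le_card) simp
  moreover have "\<dots> \<le> card Z" by (rule card_image_le) simp
  ultimately show False using assms(2) by simp
qed

lemma MDS_eq_0:
  assumes "is_MDS C" "x \<in> C" "vec.dim C \<le> card Z" "\<And>i. i \<in> Z \<Longrightarrow> x $ i = 0"
  shows "x = 0"
proof (rule ccontr)
  assume "x \<noteq> 0"
  have "finite (hamming_weight ` (C - {0}))"
    by (rule finite_subset[of _ "{..CARD('b)}"]) (auto simp: hamming_weight_def card_mono)
  then have "min_distance C \<le> hamming_weight x"
    unfolding min_distance_def using \<open>x \<in> C\<close> \<open>x \<noteq> 0\<close> by (intro Min_le) auto
  also have "\<dots> \<le> card (- Z)"
    unfolding hamming_weight_def using assms(4) by (intro card_mono) auto
  also have "\<dots> = CARD('b) - card Z" by (simp add: Compl_eq_Diff_UNIV card_Diff_subset)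
  moreover have "card Z \<le> CARD('b)" by (simp add: card_mono)
  ultimately show False using assms(1,3) unfolding is_MDS_def by linarith
qed

text \<open>Enlarge \<open>Z0\<close> to \<open>dim C - 1\<close> points avoiding \<open>i\<close>.
  A nonzero word vanishing there exists by dimension, and a zero at \<open>i\<close> would be its
  \<open>dim C\<close>-th.\<close>

lemma MDS_separate:
  fixes C :: "('a::field, 'n::finite) code"
  assumes C: "is_MDS C" and Z0: "card Z0 < vec.dim C" "i \<notin> Z0"
  shows "\<exists>x\<in>C. (\<forall>j\<in>Z0. x $ j = 0) \<and> x $ i = 1"
proof -
  have C0: "vec.subspace C" using C by (simp add: is_MDS_def)
  have "\<exists>Z. Z0 \<subseteq> Z \<and> Z \<subseteq> UNIV - {i} \<and> card Z = vec.dim C - 1"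
  proof (rule exists_subset_between)
    show "vec.dim C - 1 \<le> card (UNIV - {i})" using dim_subset_UNIV_cart_gen[of C] by simp
  qed (use Z0 in auto)
  then obtain Z where Z: "Z0 \<subseteq> Z" "Z \<subseteq> UNIV - {i}" "card Z = vec.dim C - 1"
    by blast
  have "card Z < vec.dim C" using Z Z0 by linarith
  then obtain x where x: "x \<in> C" "x \<noteq> 0" "\<forall>j\<in>Z. x $ j = 0"
    using exists_nonzero_vanishing[OF C0, of Z] by blast
  have "x $ i \<noteq> 0"
  proof
    assume "x $ i = 0"
    then have "x = 0"
      using x Z Z0 by (intro MDS_eq_0[OF C, of x "insert i Z"]) (auto simp: card_insert_if)
    with x show False by simp
  qed
  then show ?thesis
    using x Z by (intro bexI[of _ "(1 / x $ i) *s x"] vec.subspace_scale[OF C0]) auto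
qed

text \<open>Split \<open>T\<close> into at most \<open>dim C - 1\<close> zeros for a factor from
  \<open>C\<close> and at most \<open>dim D - 1\<close> for a factor from \<open>D\<close>.\<close>

lemma code_prod_separate:
  fixes C D :: "('a::field, 'n::finite) code"
  assumes C: "is_MDS C" and D: "is_MDS D" and T: "card T < vec.dim C + vec.dim D - 1" "i \<notin> T"
    and pos: "vec.dim C > 0" "vec.dim D > 0"
  shows "\<exists>x\<in>code_prod C D. (\<forall>j\<in>T. x $ j = 0) \<and> x $ i = 1"
proof -
  obtain A where A: "A \<subseteq> T" "card A = min (card T) (vec.dim C - 1)"
    by (meson min.cobounded1 obtain_subset_with_card_n)
  obtain c where c: "c \<in> C" "\<forall>j\<in>A. c $ j = 0" "c $ i = 1"
    using MDS_separate[OF C, of A i] A T pos by fastforce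
  have "card (T - A) < vec.dim D"
    using A T pos by (subst card_Diff_subset) auto
  then obtain d where d: "d \<in> D" "\<forall>j\<in>T - A. d $ j = 0" "d $ i = 1"
    using MDS_separate[OF D, of "T - A" i] T by auto
  have "c * d \<in> code_prod C D"
    unfolding code_prod_def using c(1) d(1) by (intro vec.span_base) blast
  then show ?thesis using c d by (intro bexI[of _ "c * d"]) auto
qed

text \<open>Lagrange interpolation: the matrix of the \<open>b t\<close> on \<open>T\<close> is the
  identity, so they form a basis and coefficients are read off on \<open>T\<close>.\<close>

lemma interpolating_basis:
  fixes V :: "('a::field, 'n::finite) code"
  assumes T: "card T = vec.dim V"
    and b: "\<And>t. t \<in> T \<Longrightarrow> b t \<in> V" "\<And>s t. s \<in> T \<Longrightarrow> t \<in> T \<Longrightarrow> b t $ s = (if s = t then 1 else 0)"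
    and x: "x \<in> V"
  shows "x = (\<Sum>t\<in>T. x $ t *s b t)"
proof -
  have val: "(\<Sum>t\<in>T. r t *s b t) $ s = r s" if "s \<in> T" for r s
  proof -
    have "(\<Sum>t\<in>T. r t *s b t) $ s = (\<Sum>t\<in>T. if s = t then r t else 0)"
      using that by (simp add: b(2) if_distrib[of "\<lambda>z. _ * z"] cong: sum.cong if_cong)
    then show ?thesis using that by simp
  qed
  have "\<exists>r. x = (\<Sum>t\<in>T. r t *s b t)"
  proof (rule in_lincombs_if_card_eq_dim[OF _ b(1) T _ x])
    show "r t = 0" if "(\<Sum>t\<in>T. r t *s b t) = 0" "t \<in> T" for r t
      using val[OF that(2), of r] that(1) by simp
  qed simp_all
  then obtain r where r: "x = (\<Sum>t\<in>T. r t *s b t)" by blast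
  then have "x $ t = r t" if "t \<in> T" for t using val that by simp
  with r show ?thesis by simp
qed

subsection \<open>Geometric sequences as evaluations of monomials\<close>

lemma eval_point_monom_sum:
  assumes "degree f < k"
  shows "eval_point k f \<alpha> = (\<Sum>a<k. coeff f a * eval_point k (monom 1 a) \<alpha>)"
proof (cases \<alpha>)
  case None
  then show ?thesis using assms by (simp add: if_distrib[of "\<lambda>z. _ * z"] sum.delta cong: if_cong)
next
  case (Some z)
  have "poly f z = (\<Sum>a\<le>degree f. coeff f a * z ^ a)" by (rule poly_altdef)
  also have "\<dots> = (\<Sum>a<k. coeff f a * z ^ a)"
    using assms by (intro sum.mono_neutral_left) (auto simp: coeff_eq_0)
  finally show ?thesis using Some by (simp add: poly_monom)
qed

text \<open>The common ratio is the projective point (\<open>s\<close> : \<open>t\<close>). For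
  \<open>s = 0\<close> all terms but the last vanish, which is how monomials behave at
  infinity.\<close>

lemma geometric_eval:
  fixes l :: "nat \<Rightarrow> 'a::field"
  assumes st: "s \<noteq> 0 \<or> t \<noteq> 0" and k: "k > 0"
    and l: "\<And>a. Suc a < k \<Longrightarrow> l a * t = l (Suc a) * s" and nz: "\<exists>a<k. l a \<noteq> 0"
  shows "\<exists>g. g \<noteq> 0 \<and> (\<forall>a<k. l a = g * eval_point k (monom 1 a) (if s = 0 then None else Some (t / s)))"
proof (cases "s = 0")
  case True
  have z: "l a = 0" if "Suc a < k" for a using l[OF that] True st by simp
  have v: "l a = l (k - 1) * eval_point k (monom 1 a) None" if "a < k" for a
    using z[of a] that by (cases "a = k - 1") auto
  have "l (k - 1) \<noteq> 0" using nz v by (metis mult_zero_left)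
  with v have "l (k - 1) \<noteq> 0 \<and> (\<forall>a<k. l a = l (k - 1) * eval_point k (monom 1 a) None)" by blast
  then show ?thesis unfolding if_P[OF True] by (intro exI[of _ "l (k - 1)"])
next
  case False
  have v: "l a = l 0 * (t / s) ^ a" if "a < k" for a
    using that
  proof (induction a)
    case (Suc a)
    then have "l (Suc a) * s = l 0 * (t / s) ^ a * t" using l[of a] by simp
    then show ?case using False by (simp add: eq_divide_eq)
  qed simp
  have "l 0 \<noteq> 0" using nz v by (metis mult_zero_left)
  moreover have "l a = l 0 * eval_point k (monom 1 a) (Some (t / s))" if "a < k" for a
    using v[OF that] by (simp add: poly_monom)
  ultimately have "l 0 \<noteq> 0 \<and> (\<forall>a<k. l a = l 0 * eval_point k (monom 1 a) (Some (t / s)))" by blast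
  then show ?thesis unfolding if_not_P[OF False] by (intro exI[of _ "l 0"])
qed

text \<open>A consecutive pair of \<open>m\<close>, not both zero, gives the ratio of
  \<open>l\<close>, and conversely; \<open>lm\<close> for these two pairs says that they are the
  same projective point.\<close>

lemma geometric_pair_eval:
  fixes l m :: "nat \<Rightarrow> 'a::field"
  assumes k: "k \<ge> 2" and k': "k' \<ge> 2"
    and lm: "\<And>a b. Suc a < k \<Longrightarrow> Suc b < k' \<Longrightarrow> l a * m (Suc b) = l (Suc a) * m b"
    and l: "\<exists>a<k. l a \<noteq> 0" and m: "\<exists>b<k'. m b \<noteq> 0"
  shows "\<exists>\<alpha> g h. g \<noteq> 0 \<and> h \<noteq> 0 \<and> (\<forall>a<k. l a = g * eval_point k (monom 1 a) \<alpha>) \<and>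
    (\<forall>b<k'. m b = h * eval_point k' (monom 1 b) \<alpha>)"
proof -
  obtain b0 where b0: "b0 < k'" "m b0 \<noteq> 0" using m by auto
  \<comment> \<open>The pair must contain the nonzero entry at \<open>b0\<close>; if
    \<open>b0\<close> is the last index, it starts one earlier.\<close>
  define b where "b = (if Suc b0 < k' then b0 else b0 - 1)"
  have b: "Suc b < k'" "m b \<noteq> 0 \<or> m (Suc b) \<noteq> 0" using b0 k' by (auto simp: b_def)
  obtain a0 where a0: "a0 < k" "l a0 \<noteq> 0" using l by auto
  define a where "a = (if Suc a0 < k then a0 else a0 - 1)"
  have a: "Suc a < k" "l a \<noteq> 0 \<or> l (Suc a) \<noteq> 0" using a0 k by (auto simp: a_def)
  define \<alpha> where "\<alpha> = (if m b = 0 then None else Some (m (Suc b) / m b))"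
  have "\<exists>g. g \<noteq> 0 \<and> (\<forall>a<k. l a = g * eval_point k (monom 1 a) \<alpha>)"
    unfolding \<alpha>_def by (rule geometric_eval) (use b k lm l in auto)
  moreover have "\<exists>h. h \<noteq> 0 \<and> (\<forall>b<k'. m b = h * eval_point k' (monom 1 b) \<beta>)"
    if "\<beta> = (if l a = 0 then None else Some (l (Suc a) / l a))" for \<beta>
    unfolding that by (rule geometric_eval) (use a k' lm m in \<open>auto simp: mult.commute\<close>)
  moreover have "\<alpha> = (if l a = 0 then None else Some (l (Suc a) / l a))"
    using lm[OF a(1) b(1)] a(2) b(2) unfolding \<alpha>_def by (auto simp: field_simps)
  ultimately show ?thesis by blast
qed

subsection \<open>Parity checks of the product code\<close>

text \<open>The value of a word at \<open>p\<close> is a linear function of its values on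
  \<open>T\<close>; \<open>u\<close> records this relation.\<close>

lemma parity_check:
  fixes V :: "('a::field, 'n::finite) code"
  assumes T: "card T = vec.dim V"
    and b: "\<And>t. t \<in> T \<Longrightarrow> b t \<in> V" "\<And>s t. s \<in> T \<Longrightarrow> t \<in> T \<Longrightarrow> b t $ s = (if s = t then 1 else 0)"
    and p: "p \<notin> T"
  obtains u where "u $ p = 1" "\<And>i. i \<notin> insert p T \<Longrightarrow> u $ i = 0"
    "\<And>x. x \<in> V \<Longrightarrow> (\<Sum>i\<in>UNIV. u $ i * x $ i) = 0"
proof
  define u where "u = (\<chi> i. if i = p then 1 else if i \<in> T then - b i $ p else 0)"
  show "u $ p = 1" by (simp add: u_def)
  show "u $ i = 0" if "i \<notin> insert p T" for i using that by (simp add: u_def)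
  fix x assume x: "x \<in> V"
  have "x = (\<Sum>t\<in>T. x $ t *s b t)" by (rule interpolating_basis[OF T b x])
  then have xp: "x $ p = (\<Sum>t\<in>T. x $ t * b t $ p)"
    by (metis (no_types, lifting) sum.cong sum_component vector_smult_component)
  have "(\<Sum>i\<in>UNIV. u $ i * x $ i) = (\<Sum>i\<in>insert p T. u $ i * x $ i)"
    by (rule sum.mono_neutral_right) (auto simp: u_def)
  also have "\<dots> = x $ p + (\<Sum>i\<in>T. u $ i * x $ i)" using p by (simp add: u_def)
  also have "(\<Sum>i\<in>T. u $ i * x $ i) = (\<Sum>i\<in>T. - (x $ i * b i $ p))"
    using p by (intro sum.cong) (auto simp: u_def)
  finally show "(\<Sum>i\<in>UNIV. u $ i * x $ i) = 0" by (simp add: xp sum_negf)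
qed

text \<open>By \<open>dim\<close>, removing one point from \<open>T\<close> leaves
  \<open>dim C + dim D - 2\<close> zeros to prescribe, within reach of
  \<open>code_prod_separate\<close>.\<close>

lemma code_prod_basis:
  fixes C D :: "('a::field, 'n::finite) code"
  assumes "is_MDS C" "is_MDS D" "vec.dim C > 0" "vec.dim D > 0"
    and dim: "vec.dim (code_prod C D) + 1 = vec.dim C + vec.dim D"
    and T: "card T = vec.dim (code_prod C D)"
  obtains b where "\<And>t. t \<in> T \<Longrightarrow> b t \<in> code_prod C D"
    "\<And>s t. s \<in> T \<Longrightarrow> t \<in> T \<Longrightarrow> b t $ s = (if s = t then 1 else 0)"
proof -
  have "\<exists>x\<in>code_prod C D. (\<forall>j\<in>T - {t}. x $ j = 0) \<and> x $ t = 1" if "t \<in> T" for t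
  proof (rule code_prod_separate)
    have "card T > 0" using that by (auto simp: card_gt_0_iff)
    then show "card (T - {t}) < vec.dim C + vec.dim D - 1" using that T dim by simp
  qed (use assms in auto)
  then obtain b where "\<forall>t\<in>T. b t \<in> code_prod C D \<and> (\<forall>j\<in>T - {t}. b t $ j = 0) \<and> b t $ t = 1"
    by metis
  then show ?thesis by (intro that[of b]) auto
qed

lemma code_prod_eq_0:
  fixes C D :: "('a::field, 'n::finite) code"
  assumes CD: "is_MDS C" "is_MDS D" "vec.dim C > 0" "vec.dim D > 0"
    and dim: "vec.dim (code_prod C D) + 1 = vec.dim C + vec.dim D"
    and x: "x \<in> code_prod C D" and Z: "vec.dim (code_prod C D) \<le> card Z" "\<And>i. i \<in> Z \<Longrightarrow> x $ i = 0"
  shows "x = 0"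
proof -
  obtain T where T: "T \<subseteq> Z" "card T = vec.dim (code_prod C D)"
    using Z(1) by (meson obtain_subset_with_card_n)
  obtain b where "\<And>t. t \<in> T \<Longrightarrow> b t \<in> code_prod C D"
    "\<And>s t. s \<in> T \<Longrightarrow> t \<in> T \<Longrightarrow> b t $ s = (if s = t then 1 else 0)"
    using code_prod_basis[OF CD dim T(2)] by blast
  then have "x = (\<Sum>t\<in>T. x $ t *s b t)" by (rule interpolating_basis[OF T(2) _ _ x])
  also have "\<dots> = 0" using T(1) Z(2) by (intro sum.neutral) auto
  finally show ?thesis .
qed

text \<open>The checks express the values at two points \<open>p\<close> and \<open>q\<close> of
  \<open>S\<close> through those on the rest. A combination vanishing at two points of
  \<open>S\<close> is a check supported on \<open>dim CD\<close> positions; product words isolating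
  each of these force it to be zero.\<close>

lemma code_prod_parity_checks:
  fixes C D :: "('a::field, 'n::finite) code"
  assumes CD: "is_MDS C" "is_MDS D" "vec.dim C > 0" "vec.dim D > 0"
    and dim: "vec.dim (code_prod C D) + 1 = vec.dim C + vec.dim D"
    and S: "card S = vec.dim (code_prod C D) + 2"
  obtains u v where "pairwise_independent_on S u v" "\<And>i. i \<notin> S \<Longrightarrow> u $ i = 0" "\<And>i. i \<notin> S \<Longrightarrow> v $ i = 0"
    "\<And>x. x \<in> code_prod C D \<Longrightarrow> (\<Sum>i\<in>UNIV. u $ i * x $ i) = 0"
    "\<And>x. x \<in> code_prod C D \<Longrightarrow> (\<Sum>i\<in>UNIV. v $ i * x $ i) = 0"
proof -
  have "vec.dim (code_prod C D) \<le> card S" using S by simp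
  then obtain T where T: "T \<subseteq> S" "card T = vec.dim (code_prod C D)"
    by (meson obtain_subset_with_card_n)
  have "card (S - T) = 2" using S T by (simp add: card_Diff_subset)
  then obtain p q where pq: "S - T = {p, q}" "p \<noteq> q" by (meson card_2_iff)
  then have pqS: "p \<notin> T" "q \<notin> T" "S = insert p (insert q T)" using T by auto
  obtain b where b: "\<And>t. t \<in> T \<Longrightarrow> b t \<in> code_prod C D"
    "\<And>s t. s \<in> T \<Longrightarrow> t \<in> T \<Longrightarrow> b t $ s = (if s = t then 1 else 0)"
    using code_prod_basis[OF CD dim T(2)] by blast
  obtain u where u: "u $ p = 1" "\<And>i. i \<notin> insert p T \<Longrightarrow> u $ i = 0"
    "\<And>x. x \<in> code_prod C D \<Longrightarrow> (\<Sum>i\<in>UNIV. u $ i * x $ i) = 0"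
    using parity_check[OF T(2) b pqS(1)] by blast
  obtain v where v: "v $ q = 1" "\<And>i. i \<notin> insert q T \<Longrightarrow> v $ i = 0"
    "\<And>x. x \<in> code_prod C D \<Longrightarrow> (\<Sum>i\<in>UNIV. v $ i * x $ i) = 0"
    using parity_check[OF T(2) b pqS(2)] by blast
  have uq: "u $ q = 0" and vp: "v $ p = 0" using u(2) v(2) pq(2) pqS by auto
  have "pairwise_independent_on S u v"
    unfolding pairwise_independent_on_def
  proof (intro ballI impI notI)
    fix i j assume ij: "i \<in> S" "j \<in> S" "i \<noteq> j" and eq: "u $ i * v $ j = u $ j * v $ i"
    \<comment> \<open>The vanishing determinant gives a nontrivial combination of \<open>u\<close>
      and \<open>v\<close> that is zero at both \<open>i\<close> and \<open>j\<close>; zero columns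
      need other coefficients.\<close>
    obtain s t where st: "s \<noteq> 0 \<or> t \<noteq> 0" "s * u $ i + t * v $ i = 0" "s * u $ j + t * v $ j = 0"
    proof (cases "u $ i = 0 \<and> v $ i = 0")
      case False
      then show ?thesis using eq by (intro that[of "v $ i" "- u $ i"]) (auto simp: algebra_simps)
    next
      case True
      show ?thesis
      proof (cases "u $ j = 0 \<and> v $ j = 0")
        case False
        then show ?thesis using True by (intro that[of "v $ j" "- u $ j"]) auto
      next
        case True
        with \<open>u $ i = 0 \<and> v $ i = 0\<close> show ?thesis by (intro that[of 1 0]) auto
      qed
    qed
    define w where "w = s *s u + t *s v"
    have w_ortho: "(\<Sum>m\<in>UNIV. w $ m * x $ m) = 0" if "x \<in> code_prod C D" for x
    proof -
      have "(\<Sum>m\<in>UNIV. w $ m * x $ m) = s * (\<Sum>m\<in>UNIV. u $ m * x $ m) + t * (\<Sum>m\<in>UNIV. v $ m * x $ m)"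
        by (simp add: w_def sum_distrib_left sum.distrib algebra_simps)
      then show ?thesis using u(3) v(3) that by simp
    qed
    have w_off: "w $ m = 0" if "m \<notin> S - {i, j}" for m
      using that st u(2)[of m] v(2)[of m] pqS by (auto simp: w_def)
    have "w $ m = 0" for m
    proof (cases "m \<in> S - {i, j}")
      case True
      have cR: "card (S - {i, j}) = vec.dim (code_prod C D)"
        using ij S by (simp add: card_Diff_subset)
      have "card (S - {i, j} - {m}) = vec.dim (code_prod C D) - 1"
        using True cR by (simp only: card_Diff_singleton)
      moreover have "card (S - {i, j}) > 0" using True by (auto simp: card_gt_0_iff)
      ultimately have "card (S - {i, j} - {m}) < vec.dim C + vec.dim D - 1" using dim cR by linarith
      then obtain x where x: "x \<in> code_prod C D" "\<forall>n\<in>S - {i, j} - {m}. x $ n = 0" "x $ m = 1"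
        using code_prod_separate[OF CD(1,2) _ _ CD(3,4), of "S - {i, j} - {m}" m] by auto
      have "(\<Sum>n\<in>UNIV. w $ n * x $ n) = (\<Sum>n\<in>{m}. w $ n * x $ n)"
        using x(2) w_off by (intro sum.mono_neutral_right) auto
      with w_ortho[OF x(1)] x(3) show ?thesis by simp
    qed (use w_off in auto)
    \<comment> \<open>These two values are \<open>s\<close> and \<open>t\<close>.\<close>
    then have "w $ p = 0" "w $ q = 0" by auto
    then show False using st(1) u(1) v(1) uq vp by (auto simp: w_def)
  qed
  with u v pqS show ?thesis by (intro that[of u v]) auto
qed

subsection \<open>From the product equality to Reed-Solomon codes\<close>

lemma mds_on_restrict:
  fixes C :: "('a::field, 'n::finite) code"
  assumes C: "is_MDS C" and S: "vec.dim C \<le> card S"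
  shows "mds_on S (vec.dim C) {x. \<exists>c\<in>C. \<forall>i\<in>S. x $ i = c $ i}" (is "mds_on S _ ?V")
  unfolding mds_on_def
proof (intro conjI ballI allI impI)
  have C0: "vec.subspace C" using C by (simp add: is_MDS_def)
  show "vec.subspace ?V"
    unfolding vec.subspace_def
  proof (intro conjI ballI allI)
    show "0 \<in> ?V" using vec.subspace_0[OF C0] by (intro CollectI bexI[of _ 0]) auto
  next
    fix x y assume "x \<in> ?V" "y \<in> ?V"
    then obtain c d where "c \<in> C" "d \<in> C" "\<forall>i\<in>S. x $ i = c $ i" "\<forall>i\<in>S. y $ i = d $ i" by blast
    then show "x + y \<in> ?V"
      using vec.subspace_add[OF C0, of c d] by (intro CollectI bexI[of _ "c + d"]) auto
  next
    fix r x assume "x \<in> ?V"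
    then obtain c where "c \<in> C" "\<forall>i\<in>S. x $ i = c $ i" by blast
    then show "r *s x \<in> ?V"
      using vec.subspace_scale[OF C0, of c r] by (intro CollectI bexI[of _ "r *s c"]) auto
  qed
next
  fix x y assume "x \<in> ?V" "\<forall>i\<in>S. y $ i = x $ i"
  then show "y \<in> ?V" by auto
next
  show "few_zeros S (vec.dim C) ?V"
    unfolding few_zeros_def
  proof (intro ballI allI impI)
    fix x Z i assume "x \<in> ?V" and Z: "Z \<subseteq> S" "vec.dim C \<le> card Z" "\<forall>i\<in>Z. x $ i = 0" and i: "i \<in> S"
    then obtain c where c: "c \<in> C" "\<forall>i\<in>S. x $ i = c $ i" by blast
    have "c = 0" by (rule MDS_eq_0[OF C c(1) Z(2)]) (use Z c in \<open>metis subsetD\<close>)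
    with c i show "x $ i = 0" by simp
  qed
next
  fix Z assume Z: "Z \<subseteq> S" "card Z < vec.dim C"
  then have "card Z < card S" using S by simp
  then obtain i where i: "i \<in> S" "i \<notin> Z" by (meson card_mono finite linorder_not_less subsetI)
  obtain c where "c \<in> C" "\<forall>j\<in>Z. c $ j = 0" "c $ i = 1"
    using MDS_separate[OF C Z(2) i(2)] by blast
  with i(1) show "\<exists>x\<in>?V. (\<forall>i\<in>Z. x $ i = 0) \<and> (\<exists>i\<in>S. x $ i \<noteq> 0)"
    by (intro bexI[of _ c]) (auto intro!: bexI[of _ i])
qed

lemma geometric_codewords:
  fixes C D :: "('a::field, 'n::finite) code"
  assumes C: "is_MDS C" and D: "is_MDS D" and pos: "vec.dim C > 0" "vec.dim D > 0"
    and S: "card S = vec.dim C + vec.dim D + 1"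
    and uv: "pairwise_independent_on S u v"
    and u: "\<And>i. i \<notin> S \<Longrightarrow> u $ i = 0" "\<And>c d. c \<in> C \<Longrightarrow> d \<in> D \<Longrightarrow> (\<Sum>i\<in>UNIV. u $ i * (c $ i * d $ i)) = 0"
    and v: "\<And>i. i \<notin> S \<Longrightarrow> v $ i = 0" "\<And>c d. c \<in> C \<Longrightarrow> d \<in> D \<Longrightarrow> (\<Sum>i\<in>UNIV. v $ i * (c $ i * d $ i)) = 0"
  obtains g c where "\<And>i. i \<in> S \<Longrightarrow> g $ i \<noteq> 0" "\<And>a. a < vec.dim C \<Longrightarrow> c a \<in> C"
    "\<And>a i. a < vec.dim C \<Longrightarrow> i \<in> S \<Longrightarrow> c a $ i = g $ i * u $ i ^ a * v $ i ^ (vec.dim C - 1 - a)"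
proof -
  obtain k where k: "vec.dim C = Suc k" using pos(1) by (cases "vec.dim C") auto
  define V where "V = {x. \<exists>c\<in>C. \<forall>i\<in>S. x $ i = c $ i}"
  \<comment> \<open>The dual on \<open>S\<close> of \<open>D\<close>. It contains
    \<open>u * x\<close> and \<open>v * x\<close> for \<open>x\<close> in \<open>V\<close>, since
    \<open>u\<close> and \<open>v\<close> are orthogonal to all products.\<close>
  define E where "E = {x. \<forall>d\<in>D. (\<Sum>i\<in>S. x $ i * d $ i) = 0}"
  have V: "mds_on S (Suc k) V"
    using mds_on_restrict[OF C, of S] S k by (simp add: V_def)
  have E0: "vec.subspace E"
    unfolding vec.subspace_def E_def
    by (auto simp: distrib_right sum.distrib mult.assoc simp flip: sum_distrib_left)
  have Ef: "few_zeros S (k + 2) E"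
    unfolding few_zeros_def
  proof (intro ballI allI impI)
    fix x Z i assume x: "x \<in> E" and Z: "Z \<subseteq> S" "k + 2 \<le> card Z" "\<forall>i\<in>Z. x $ i = 0" and i: "i \<in> S"
    show "x $ i = 0"
    proof (cases "i \<in> Z")
      case False
      \<comment> \<open>Apart from \<open>i\<close>, fewer than \<open>dim D\<close> positions of
        \<open>S\<close> lie outside \<open>Z\<close>, so a word of \<open>D\<close> isolates
        \<open>x $ i\<close> in the orthogonality relation.\<close>
      have "card (S - Z - {i}) = card S - card Z - 1"
        using False i Z by (simp add: card_Diff_subset)
      then have "card (S - Z - {i}) < vec.dim D" using S Z k pos by linarith
      then obtain d where d: "d \<in> D" "\<forall>j\<in>S - Z - {i}. d $ j = 0" "d $ i = 1"
        using MDS_separate[OF D, of "S - Z - {i}" i] by auto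
      have "(\<Sum>j\<in>S. x $ j * d $ j) = (\<Sum>j\<in>{i}. x $ j * d $ j)"
        using d(2) i Z by (intro sum.mono_neutral_right) auto
      with x d show ?thesis by (simp add: E_def)
    qed (use Z in auto)
  qed
  have VE: "w * x \<in> E"
    if "x \<in> V" and w: "\<And>i. i \<notin> S \<Longrightarrow> w $ i = 0" "\<And>c d. c \<in> C \<Longrightarrow> d \<in> D \<Longrightarrow> (\<Sum>i\<in>UNIV. w $ i * (c $ i * d $ i)) = 0"
    for w x
  proof -
    obtain c where c: "c \<in> C" "\<forall>i\<in>S. x $ i = c $ i" using \<open>x \<in> V\<close> by (auto simp: V_def)
    have "(\<Sum>i\<in>S. (w * x) $ i * d $ i) = 0" if "d \<in> D" for d
    proof -
      have "(\<Sum>i\<in>S. (w * x) $ i * d $ i) = (\<Sum>i\<in>S. w $ i * (c $ i * d $ i))"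
        using c(2) by (intro sum.cong) (auto simp: mult.assoc)
      also have "\<dots> = (\<Sum>i\<in>UNIV. w $ i * (c $ i * d $ i))"
        using w(1) by (intro sum.mono_neutral_left) auto
      finally show ?thesis using w(2)[OF c(1) that] by simp
    qed
    then show ?thesis by (simp add: E_def)
  qed
  have "k + 2 \<le> card S" using S k pos by simp
  from mds_on_geometric[OF uv V this Ef E0 VE[OF _ u] VE[OF _ v]]
  obtain g where g: "\<forall>i\<in>S. g $ i \<noteq> 0" "\<forall>a\<le>k. (\<chi> i. g $ i * u $ i ^ a * v $ i ^ (k - a)) \<in> V"
    by blast
  have "\<forall>a. \<exists>c. a \<le> k \<longrightarrow> c \<in> C \<and> (\<forall>i\<in>S. c $ i = g $ i * u $ i ^ a * v $ i ^ (k - a))"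
    using g(2) unfolding V_def by fastforce
  then obtain c where "\<forall>a. a \<le> k \<longrightarrow> c a \<in> C \<and> (\<forall>i\<in>S. c a $ i = g $ i * u $ i ^ a * v $ i ^ (k - a))"
    by metis
  with g(1) show ?thesis by (intro that[of g c]) (auto simp: k)
qed

text \<open>A relation among the \<open>c a\<close> is a polynomial of degree below
  \<open>dim C\<close> with the roots \<open>u_i / v_i\<close>. At most one point of
  \<open>S\<close> lies at infinity, leaving at least \<open>dim C\<close> distinct roots.\<close>

lemma geometric_codewords_generate:
  fixes C :: "('a::field, 'n::finite) code"
  assumes S: "card S > vec.dim C" and uv: "pairwise_independent_on S u v"
    and g: "\<And>i. i \<in> S \<Longrightarrow> g $ i \<noteq> 0" and c: "\<And>a. a < vec.dim C \<Longrightarrow> c a \<in> C"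
    and c_eq: "\<And>a i. a < vec.dim C \<Longrightarrow> i \<in> S \<Longrightarrow> c a $ i = g $ i * u $ i ^ a * v $ i ^ (vec.dim C - 1 - a)"
    and x: "x \<in> C"
  shows "\<exists>r. x = (\<Sum>a<vec.dim C. r a *s c a)"
proof (rule in_lincombs_if_card_eq_dim[OF _ _ _ _ x])
  let ?k = "vec.dim C"
  fix r a assume sum0: "(\<Sum>a<?k. r a *s c a) = 0" and a: "a \<in> {..<?k}"
  define f where "f = (\<Sum>a<?k. monom (r a) a)"
  have coeff_f: "coeff f b = (if b < ?k then r b else 0)" for b
    by (simp add: f_def coeff_sum)
  define R where "R = {i \<in> S. v $ i \<noteq> 0}"
  have "card (S - R) \<le> 1"
  proof (rule card_le_Suc0_iff_eq[THEN iffD2, folded One_nat_def])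
    show "\<forall>i\<in>S - R. \<forall>j\<in>S - R. i = j"
      using uv unfolding pairwise_independent_on_def R_def by fastforce
  qed simp
  moreover have "card (S - R) = card S - card R" by (rule card_Diff_subset) (auto simp: R_def)
  ultimately have R: "card R \<ge> ?k" using S by linarith
  have inj: "inj_on (\<lambda>i. u $ i / v $ i) R"
    using uv unfolding pairwise_independent_on_def R_def inj_on_def
    by (auto simp: frac_eq_eq)
  have "f = 0"
  proof (rule poly_eqI_degree[of "(\<lambda>i. u $ i / v $ i) ` R"])
    fix y assume "y \<in> (\<lambda>i. u $ i / v $ i) ` R"
    then obtain i where i: "i \<in> S" "v $ i \<noteq> 0" "y = u $ i / v $ i" by (auto simp: R_def)
    have "0 = (\<Sum>a<?k. r a *s c a) $ i" by (simp add: sum0)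
    also have "\<dots> = (\<Sum>a<?k. r a * (g $ i * u $ i ^ a * v $ i ^ (?k - 1 - a)))"
      using i(1) by (simp add: c_eq)
    also have "\<dots> = (\<Sum>a<?k. g $ i * v $ i ^ (?k - 1) * (r a * y ^ a))"
    proof (rule sum.cong)
      fix a assume a: "a \<in> {..<?k}"
      have "v $ i ^ (?k - 1) = v $ i ^ (?k - 1 - a) * v $ i ^ a"
        using a by (simp flip: power_add)
      then show "r a * (g $ i * u $ i ^ a * v $ i ^ (?k - 1 - a)) = g $ i * v $ i ^ (?k - 1) * (r a * y ^ a)"
        using i by (simp add: power_divide)
    qed simp
    also have "\<dots> = g $ i * v $ i ^ (?k - 1) * poly f y"
      by (simp add: f_def poly_sum poly_monom sum_distrib_left)
    finally show "poly f y = poly 0 y" using i g[of i] by simp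
  next
    have "degree f < ?k"
      using a by (intro degree_lessI) (auto simp: coeff_f)
    then show "degree f < card ((\<lambda>i. u $ i / v $ i) ` R)" using R by (simp add: card_image[OF inj])
    then show "degree 0 < card ((\<lambda>i. u $ i / v $ i) ` R)" by simp
  qed
  then show "r a = 0" using coeff_f[of a] a by simp
qed (use c in auto)

lemma RS_code_eqI:
  fixes C :: "('a::field, 'n::finite) code"
  assumes C: "vec.subspace C" and "k \<ge> 1" and c: "\<And>a. a < k \<Longrightarrow> c a \<in> C"
    and gen: "\<And>x. x \<in> C \<Longrightarrow> \<exists>r. x = (\<Sum>a<k. r a *s c a)"
    and c_eq: "\<And>a i. a < k \<Longrightarrow> c a $ i = g i * eval_point k (monom 1 a) (\<alpha> i)"
  shows "C = RS_code k g \<alpha>"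
proof -
  have eval: "(\<chi> i. g i * eval_point k f (\<alpha> i)) = (\<Sum>a<k. coeff f a *s c a)" if "degree f < k" for f
    by (simp add: vec_eq_iff eval_point_monom_sum[OF that] c_eq sum_distrib_left algebra_simps)
  show ?thesis
  proof (intro equalityI subsetI)
    fix x assume "x \<in> C"
    then obtain r where r: "x = (\<Sum>a<k. r a *s c a)" using gen by blast
    define f where "f = (\<Sum>a<k. monom (r a) a)"
    have coeff_f: "coeff f b = (if b < k then r b else 0)" for b
      by (simp add: f_def coeff_sum)
    have deg: "degree f < k" using \<open>k \<ge> 1\<close> by (intro degree_lessI) (auto simp: coeff_f)
    have "x = (\<chi> i. g i * eval_point k f (\<alpha> i))"
      unfolding eval[OF deg] r by (simp add: coeff_f)
    with deg show "x \<in> RS_code k g \<alpha>" unfolding RS_code_def by blast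
  next
    fix x assume "x \<in> RS_code k g \<alpha>"
    then obtain f where "degree f < k" "x = (\<chi> i. g i * eval_point k f (\<alpha> i))"
      unfolding RS_code_def by blast
    with c show "x \<in> C" by (auto simp: eval intro!: vec.subspace_sum[OF C] vec.subspace_scale[OF C])
  qed
qed

theorem theorem4p2:
  fixes C D :: "('a::{field,finite}, 'n::finite) code"
  assumes "is_MDS C" and "is_MDS D"
    and "vec.dim C \<ge> 2" and "vec.dim D \<ge> 2"
    and "vec.dim (code_prod C D) + 2 \<le> CARD('n)"
    and "vec.dim (code_prod C D) + 1 = vec.dim C + vec.dim D"
  shows "\<exists>\<alpha>. RS_evaluation_points \<alpha> C \<and> RS_evaluation_points \<alpha> D"
proof -
  let ?k = "vec.dim C" and ?l = "vec.dim D"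
  have C0: "vec.subspace C" and D0: "vec.subspace D"
    using assms(1,2) by (auto simp: is_MDS_def)
  have pos: "?k > 0" "?l > 0" using assms(3,4) by auto
  have prod: "c * d \<in> code_prod C D" if "c \<in> C" "d \<in> D" for c d
    unfolding code_prod_def using that by (intro vec.span_base) blast
  obtain S :: "'n set" where S: "card S = vec.dim (code_prod C D) + 2"
    using assms(5) by (meson obtain_subset_with_card_n)
  obtain u v where uv: "pairwise_independent_on S u v"
    and off: "\<And>i. i \<notin> S \<Longrightarrow> u $ i = 0" "\<And>i. i \<notin> S \<Longrightarrow> v $ i = 0"
    and ortho: "\<And>x. x \<in> code_prod C D \<Longrightarrow> (\<Sum>i\<in>UNIV. u $ i * x $ i) = 0"
      "\<And>x. x \<in> code_prod C D \<Longrightarrow> (\<Sum>i\<in>UNIV. v $ i * x $ i) = 0"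
    using code_prod_parity_checks[OF assms(1,2) pos assms(6) S] by blast
  have u': "(\<Sum>i\<in>UNIV. u $ i * (c $ i * d $ i)) = 0" and v': "(\<Sum>i\<in>UNIV. v $ i * (c $ i * d $ i)) = 0"
    if "c \<in> C" "d \<in> D" for c d
    using ortho[OF prod[OF that]] by simp_all
  have u'': "(\<Sum>i\<in>UNIV. u $ i * (d $ i * c $ i)) = 0" and v'': "(\<Sum>i\<in>UNIV. v $ i * (d $ i * c $ i)) = 0"
    if "d \<in> D" "c \<in> C" for c d
    using u'[OF that(2,1)] v'[OF that(2,1)] by (simp_all add: mult.commute)
  have S': "card S = ?k + ?l + 1" "card S = ?l + ?k + 1" using S assms(6) by auto
  obtain g c where g: "\<And>i. i \<in> S \<Longrightarrow> g $ i \<noteq> 0" and c: "\<And>a. a < ?k \<Longrightarrow> c a \<in> C"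
    and c_eq: "\<And>a i. a < ?k \<Longrightarrow> i \<in> S \<Longrightarrow> c a $ i = g $ i * u $ i ^ a * v $ i ^ (?k - 1 - a)"
    using geometric_codewords[OF assms(1,2) pos S'(1) uv off(1) u' off(2) v'] by blast
  obtain h d where h: "\<And>i. i \<in> S \<Longrightarrow> h $ i \<noteq> 0" and d: "\<And>a. a < ?l \<Longrightarrow> d a \<in> D"
    and d_eq: "\<And>a i. a < ?l \<Longrightarrow> i \<in> S \<Longrightarrow> d a $ i = h $ i * u $ i ^ a * v $ i ^ (?l - 1 - a)"
    using geometric_codewords[OF assms(2,1) pos(2,1) S'(2) uv off(1) u'' off(2) v''] by blast
  have genC: "\<exists>r. x = (\<Sum>a<?k. r a *s c a)" if "x \<in> C" for x
    by (rule geometric_codewords_generate[OF _ uv g c c_eq that]) (use S' in auto)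
  have genD: "\<exists>r. x = (\<Sum>a<?l. r a *s d a)" if "x \<in> D" for x
    by (rule geometric_codewords_generate[OF _ uv h d d_eq that]) (use S' in auto)
  have cross: "c a * d (Suc b) = c (Suc a) * d b" if ab: "Suc a < ?k" "Suc b < ?l" for a b
  proof -
    have "c a * d (Suc b) - c (Suc a) * d b \<in> code_prod C D"
      using ab prod c d unfolding code_prod_def by (intro vec.span_diff) (auto simp: code_prod_def)
    then have "c a * d (Suc b) - c (Suc a) * d b = 0"
    proof (rule code_prod_eq_0[OF assms(1,2) pos assms(6), where Z = S])
      fix i assume i: "i \<in> S"
      \<comment> \<open>On \<open>S\<close> both products have \<open>u\<close> to the power
        \<open>a + b + 1\<close> and equal powers of \<open>v\<close>; these identities settle the
        truncated subtractions in the exponents.\<close>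
      have "?k - 1 - a = Suc (?k - 1 - Suc a)" "?l - 1 - b = Suc (?l - 1 - Suc b)" using ab by auto
      then show "(c a * d (Suc b) - c (Suc a) * d b) $ i = 0"
        using ab i by (simp add: c_eq d_eq)
    qed (use S in simp)
    then show ?thesis by simp
  qed
  \<comment> \<open>The generators cannot all vanish at \<open>i\<close>, because some codeword has
    value 1 there; this makes the column multipliers nonzero.\<close>
  have nonzero: "\<exists>a<vec.dim V. w a $ i \<noteq> 0"
    if V: "is_MDS V" "vec.dim V > 0" and gen: "\<And>x. x \<in> V \<Longrightarrow> \<exists>r. x = (\<Sum>a<vec.dim V. r a *s w a)"
    for V :: "('a, 'n) code" and w i
  proof (rule ccontr)
    assume contra: "\<not> ?thesis"
    obtain x where x: "x \<in> V" "x $ i = 1" using MDS_separate[OF V(1), of "{}" i] V(2) by auto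
    obtain r where "x = (\<Sum>a<vec.dim V. r a *s w a)" using gen[OF x(1)] by blast
    with contra x(2) show False by simp
  qed
  have "\<forall>i. \<exists>\<alpha> g h. g \<noteq> 0 \<and> h \<noteq> 0 \<and> (\<forall>a<?k. c a $ i = g * eval_point ?k (monom 1 a) \<alpha>) \<and>
      (\<forall>b<?l. d b $ i = h * eval_point ?l (monom 1 b) \<alpha>)"
  proof
    fix i
    have "c a $ i * d (Suc b) $ i = c (Suc a) $ i * d b $ i" if "Suc a < ?k" "Suc b < ?l" for a b
      using cross[OF that] by (metis vector_mult_component)
    then show "\<exists>\<alpha> g h. g \<noteq> 0 \<and> h \<noteq> 0 \<and> (\<forall>a<?k. c a $ i = g * eval_point ?k (monom 1 a) \<alpha>) \<and>
      (\<forall>b<?l. d b $ i = h * eval_point ?l (monom 1 b) \<alpha>)"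
      by (rule geometric_pair_eval[OF assms(3,4) _ nonzero[OF assms(1) pos(1) genC] nonzero[OF assms(2) pos(2) genD]])
  qed
  then obtain \<alpha> g' h' where nz: "\<And>i. g' i \<noteq> 0" "\<And>i. h' i \<noteq> 0"
    and c_eval: "\<And>a i. a < ?k \<Longrightarrow> c a $ i = g' i * eval_point ?k (monom 1 a) (\<alpha> i)"
    and d_eval: "\<And>b i. b < ?l \<Longrightarrow> d b $ i = h' i * eval_point ?l (monom 1 b) (\<alpha> i)"
    by metis
  have "inj \<alpha>"
  proof (rule injI, rule ccontr)
    \<comment> \<open>Equal evaluation points would make the coordinates \<open>i\<close> and
      \<open>j\<close> proportional on all of \<open>C\<close>, but dimension at least 2 allows a
      word that is 0 at \<open>i\<close> and 1 at \<open>j\<close>.\<close>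
    fix i j assume ij: "\<alpha> i = \<alpha> j" "i \<noteq> j"
    obtain x where x: "x \<in> C" "x $ i = 0" "x $ j = 1"
      using MDS_separate[OF assms(1), of "{i}" j] assms(3) ij(2) by auto
    obtain r where r: "x = (\<Sum>a<?k. r a *s c a)" using genC[OF x(1)] by blast
    have x_eq: "x $ m = g' m * (\<Sum>a<?k. r a * eval_point ?k (monom 1 a) (\<alpha> m))" for m
      by (simp add: r c_eval sum_distrib_left algebra_simps)
    show False using x_eq[of i] x_eq[of j] x(2,3) ij(1) nz(1)[of i] by auto
  qed
  moreover have "C = RS_code ?k g' \<alpha>"
    by (rule RS_code_eqI[OF C0 _ c genC c_eval]) (use pos in auto)
  moreover have "D = RS_code ?l h' \<alpha>"
    by (rule RS_code_eqI[OF D0 _ d genD d_eval]) (use pos in auto)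
  ultimately show ?thesis
    unfolding RS_evaluation_points_def
    using nz pos dim_subset_UNIV_cart_gen[of C] dim_subset_UNIV_cart_gen[of D] by (metis One_nat_def Suc_leI)
qed

end
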